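(* Let $\Gamma$ be a bridgeless metrized graph with $v=\#V(\Gamma)\ge2$. Then $$(v-2)\,x(\Gamma)=\sum_{e_i\in E(\Gamma)}\frac{R_i}{L_i+R_i}x(\overline{\Gamma}_i),\qquad (v-2)\,y(\Gamma)=\sum_{e_i\in E(\Gamma)}\frac{R_i}{L_i+R_i}y(\overline{\Gamma}_i).$$
   Context: A metrized graph is a finite connected graph (multiple edges and self-loops allowed) whose edges $e_j$ are identified with closed segments of lengths $L_j>0$; its vertex set $V(\Gamma)$ is finite, nonempty, and contains all points of valence $\neq2$. $G-e_j$ is $G$ with the interior of $e_j$ removed; $\Gamma$ is bridgeless if each $\Gamma-e_j$ is connected. View a metrized graph $G$ as an electric circuit with edge resistances equal to lengths; the voltage function $j_z(x,y)$ is the voltage at $x$ (reference $0$ at $z$) when unit current enters at $y$ and exits at $z$. For an edge $e_j$ of $G$ with endpoints $p_j,q_j$, $R_j$ is the effective resistance between $p_j,q_j$ in $G-e_j$, and for a fixed vertex $p$, with $\hat j$ the voltage function of $G-e_j$, $R_{a_j,p}=\hat j_{p_j}(p,q_j)$, $R_{b_j,p}=\hat j_{q_j}(p_j,p)$. Define $y(G)=\frac14\sum_{e_j}\frac{L_jR_j^2}{(L_j+R_j)^2}+\frac34\sum_{e_j}\frac{L_j(R_{a_j,p}-R_{b_j,p})^2}{(L_j+R_j)^2}$, $x(G)=\sum_{e_j}\frac{L_j^2R_j}{(L_j+R_j)^2}+\frac34\sum_{e_j}\frac{L_jR_j^2}{(L_j+R_j)^2}-\frac34\sum_{e_j}\frac{L_j(R_{a_j,p}-R_{b_j,p})^2}{(L_j+R_j)^2}$.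 $\overline{\Gamma}_i$ is obtained from $\Gamma$ by contracting $e_i$ to a point; $R_i$ refers to $\Gamma$. *)

theory Defs
  imports Complex_Main "Graph_Theory.Digraph" "Graph_Theory.Digraph_Component"
begin

text \<open>
  A metrized graph is encoded by its finite vertex set, its finite set of edges (multiple edges
  and loops allowed) and the edge lengths \<open>L\<close>.  The edges are the arcs of a multi-digraph; the
  direction of an arc \<open>e\<close> is an arbitrary labelling of its two endpoints as
  \<open>p = tail G e\<close> and \<open>q = head G e\<close>.  In particular, every undirected edge is represented by
  exactly one arc, and connectedness is that of the underlying undirected graph.
\<close>

locale metrized_graph = fin_digraph G for G :: "('a, 'b) pre_digraph" +
  fixes L :: "'b \<Rightarrow> real"
  assumes connected: "Digraph_Component.connected G"
    and length_pos: "e \<in> arcs G \<Longrightarrow> 0 < L e"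

definition bridgeless :: "('a, 'b) pre_digraph \<Rightarrow> bool" where
  "bridgeless G \<longleftrightarrow> (\<forall>e \<in> arcs G. Digraph_Component.connected (pre_digraph.del_arc G e))"

text \<open>
  The contracted edge is removed and its endpoints are merged; the merged vertex is named
  after the tail.  The lengths of the remaining edges do not change.
\<close>

definition contract_arc :: "('a, 'b) pre_digraph \<Rightarrow> 'b \<Rightarrow> ('a, 'b) pre_digraph" where
  "contract_arc G e =
    (let \<pi> = (\<lambda>v. if v = head G e then tail G e else v)
     in \<lparr> verts = \<pi> ` verts G, arcs = arcs G - {e},
          tail = (\<lambda>a. \<pi> (tail G a)), head = (\<lambda>a. \<pi> (head G a)) \<rparr>)"

text \<open>
  By Ohm's law the current flowing along \<open>a\<close> from its tail to its head is
  \<open>(f (tail G a) - f (head G a)) / L a\<close>; the net current leaving \<open>v\<close> counts each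
  edge once for each of its endpoints equal to \<open>v\<close>.
\<close>

definition net_current ::
  "('a, 'b) pre_digraph \<Rightarrow> ('b \<Rightarrow> real) \<Rightarrow> ('a \<Rightarrow> real) \<Rightarrow> 'a \<Rightarrow> real" where
  "net_current G L f v =
     (\<Sum>a | a \<in> arcs G \<and> tail G a = v. (f (tail G a) - f (head G a)) / L a)
   + (\<Sum>a | a \<in> arcs G \<and> head G a = v. (f (head G a) - f (tail G a)) / L a)"

text \<open>
  \<open>voltage G L z x y\<close> is \<open>j\<^sub>z(x, y)\<close> at vertices \<open>x, y, z\<close>: the potential vanishes at \<open>z\<close>, and
  Kirchhoff's current law holds with unit current entering at \<open>y\<close> and leaving at \<open>z\<close>
  (so there is no current if \<open>y = z\<close>).  On a connected graph this determines the potential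
  on the vertices; it is extended by \<open>0\<close> outside the vertex set to be a unique function.
\<close>

definition is_potential ::
  "('a, 'b) pre_digraph \<Rightarrow> ('b \<Rightarrow> real) \<Rightarrow> 'a \<Rightarrow> 'a \<Rightarrow> ('a \<Rightarrow> real) \<Rightarrow> bool" where
  "is_potential G L z y f \<longleftrightarrow>
     f z = 0 \<and> (\<forall>v. v \<notin> verts G \<longrightarrow> f v = 0) \<and>
     (\<forall>v \<in> verts G. net_current G L f v = of_bool (v = y) - of_bool (v = z))"

definition voltage ::
  "('a, 'b) pre_digraph \<Rightarrow> ('b \<Rightarrow> real) \<Rightarrow> 'a \<Rightarrow> 'a \<Rightarrow> 'a \<Rightarrow> real" where
  "voltage G L z x y = (THE f. is_potential G L z y f) x"

definition eff_resistance ::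
  "('a, 'b) pre_digraph \<Rightarrow> ('b \<Rightarrow> real) \<Rightarrow> 'a \<Rightarrow> 'a \<Rightarrow> real" where
  "eff_resistance G L u w = voltage G L w u u"

text \<open>The resistances \<open>R_j\<close>, \<open>R_{a_j,p}\<close> and \<open>R_{b_j,p}\<close>, all computed in \<open>G - e_j\<close>.\<close>

definition edge_R :: "('a, 'b) pre_digraph \<Rightarrow> ('b \<Rightarrow> real) \<Rightarrow> 'b \<Rightarrow> real" where
  "edge_R G L e = eff_resistance (pre_digraph.del_arc G e) L (tail G e) (head G e)"

definition edge_Ra :: "('a, 'b) pre_digraph \<Rightarrow> ('b \<Rightarrow> real) \<Rightarrow> 'b \<Rightarrow> 'a \<Rightarrow> real" where
  "edge_Ra G L e p = voltage (pre_digraph.del_arc G e) L (tail G e) p (head G e)"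

definition edge_Rb :: "('a, 'b) pre_digraph \<Rightarrow> ('b \<Rightarrow> real) \<Rightarrow> 'b \<Rightarrow> 'a \<Rightarrow> real" where
  "edge_Rb G L e p = voltage (pre_digraph.del_arc G e) L (head G e) (tail G e) p"

text \<open>The invariants \<open>x(G)\<close> and \<open>y(G)\<close>, with the auxiliary vertex \<open>p\<close> as an explicit argument.\<close>

definition x_inv :: "('a, 'b) pre_digraph \<Rightarrow> ('b \<Rightarrow> real) \<Rightarrow> 'a \<Rightarrow> real" where
  "x_inv G L p =
     (\<Sum>e \<in> arcs G. (L e)^2 * edge_R G L e / (L e + edge_R G L e)^2)
   + 3/4 * (\<Sum>e \<in> arcs G. L e * (edge_R G L e)^2 / (L e + edge_R G L e)^2)
   - 3/4 * (\<Sum>e \<in> arcs G. L e * (edge_Ra G L e p - edge_Rb G L e p)^2 / (L e + edge_R G L e)^2)"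

definition y_inv :: "('a, 'b) pre_digraph \<Rightarrow> ('b \<Rightarrow> real) \<Rightarrow> 'a \<Rightarrow> real" where
  "y_inv G L p =
     1/4 * (\<Sum>e \<in> arcs G. L e * (edge_R G L e)^2 / (L e + edge_R G L e)^2)
   + 3/4 * (\<Sum>e \<in> arcs G. L e * (edge_Ra G L e p - edge_Rb G L e p)^2 / (L e + edge_R G L e)^2)"

end

theory Submission
  imports Defs
begin

text \<open>
  Let \<open>g\<close> be the Green's function of \<open>G\<close> grounded at \<open>p\<close>, and for an edge \<open>i\<close> from \<open>a\<close> to \<open>b\<close> let
  \<open>s\<^sub>i = g a - g b\<close> be the potential of the unit current from \<open>a\<close> to \<open>b\<close>, \<open>r\<^sub>i = s\<^sub>i a - s\<^sub>i b\<close> the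
  effective resistance of \<open>i\<close> in \<open>G\<close>, and \<open>d\<^sub>i = g a a - g b b\<close>.  Then \<open>R / (L + R) = r / L\<close> and
  \<open>L (R_a - R_b)\<^sup>2 / (L + R)\<^sup>2 = d\<^sup>2 / L\<close>, so \<open>y = 1/4 \<Sum> r\<^sup>2 / L + 3/4 \<Sum> d\<^sup>2 / L\<close> and \<open>x + y = \<Sum> r\<close>.

  Contracting \<open>i\<close> replaces \<open>g x y\<close> by \<open>g x y - s\<^sub>i x s\<^sub>i y / r\<^sub>i\<close>.  Multiplied by the weight \<open>r\<^sub>i / L\<^sub>i\<close> and
  summed over \<open>i\<close>, the correction terms are evaluated by Foster's identity
  \<open>\<Sum> r\<^sub>i / L\<^sub>i = v - 1\<close>, by \<open>\<Sum>\<^sub>i s\<^sub>i(x)\<^sup>2 / L\<^sub>i = g x x\<close> and by the symmetry of the differences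
  of \<open>s\<^sub>i\<close> along the edges.  The terms of fourth order in \<open>s\<^sub>i\<close> coming from the two sums in \<open>y\<close> cancel:
  this is what the coefficients 1/4 and 3/4 are for.
\<close>

section \<open>Gradients along arcs and the energy form\<close>

definition grad :: "('a, 'b) pre_digraph \<Rightarrow> ('a \<Rightarrow> real) \<Rightarrow> 'b \<Rightarrow> real" where
  "grad G f a = f (tail G a) - f (head G a)"

text \<open>This is the Dirichlet form of the circuit. Kirchhoff's law is used in weak form below:
  \<open>u\<close> is a potential of the unit current from \<open>y\<close> to \<open>z\<close> when
  \<open>energy G L u k = k y - k z\<close> for every test function \<open>k\<close>.\<close>

definition energy ::
  "('a, 'b) pre_digraph \<Rightarrow> ('b \<Rightarrow> real) \<Rightarrow> ('a \<Rightarrow> real) \<Rightarrow> ('a \<Rightarrow> real) \<Rightarrow> real" where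
  "energy G L f k = (\<Sum>a\<in>arcs G. grad G f a * grad G k a / L a)"

lemma grad_add: "grad G (\<lambda>x. f x + k x) a = grad G f a + grad G k a"
  and grad_diff: "grad G (\<lambda>x. f x - k x) a = grad G f a - grad G k a"
  and grad_scale: "grad G (\<lambda>x. c * f x) a = c * grad G f a"
  and grad_const: "grad G (\<lambda>x. c) a = 0"
  by (simp_all add: grad_def algebra_simps)

lemma energy_commute: "energy G L f k = energy G L k f"
  by (simp add: energy_def mult.commute)

lemma energy_add_left: "energy G L (\<lambda>x. f x + f' x) k = energy G L f k + energy G L f' k"
  and energy_diff_left: "energy G L (\<lambda>x. f x - f' x) k = energy G L f k - energy G L f' k"
  and energy_scale_left: "energy G L (\<lambda>x. c * f x) k = c * energy G L f k"
  and energy_const_left: "energy G L (\<lambda>x. c) k = 0"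
  by (simp_all add: energy_def grad_add grad_diff grad_scale grad_const sum.distrib sum_subtractf
      sum_distrib_left algebra_simps add_divide_distrib diff_divide_distrib)

lemma energy_add_right: "energy G L k (\<lambda>x. f x + f' x) = energy G L k f + energy G L k f'"
  and energy_diff_right: "energy G L k (\<lambda>x. f x - f' x) = energy G L k f - energy G L k f'"
  and energy_scale_right: "energy G L k (\<lambda>x. c * f x) = c * energy G L k f"
  and energy_const_right: "energy G L k (\<lambda>x. c) = 0"
  by (simp_all add: energy_commute[of G L k] energy_add_left energy_diff_left energy_scale_left
      energy_const_left)

lemmas energy_linear =
  energy_add_left energy_diff_left energy_scale_left energy_const_left
  energy_add_right energy_diff_right energy_scale_right energy_const_right

lemma energy_nonneg:
  assumes "\<And>a. a \<in> arcs G \<Longrightarrow> 0 < L a"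
  shows "0 \<le> energy G L f f"
  unfolding energy_def by (rule sum_nonneg) (simp add: assms less_imp_le)

lemma energy_del_arc:
  assumes "finite (arcs G)" "e \<in> arcs G"
  shows "energy G L f k = energy (pre_digraph.del_arc G e) L f k + grad G f e * grad G k e / L e"
  using assms by (simp add: energy_def grad_def pre_digraph.del_arc_def sum.remove)

lemma energy_insert_arc:
  assumes "finite A" "i \<notin> A"
  shows "energy (G\<lparr>arcs := insert i A\<rparr>) L f k =
    grad G f i * grad G k i / L i + energy (G\<lparr>arcs := A\<rparr>) L f k"
  using assms by (simp add: energy_def grad_def)

section \<open>Existence of potentials\<close>

abbreviation adjacency :: "('a, 'b) pre_digraph \<Rightarrow> 'b set \<Rightarrow> 'a rel" where
  "adjacency G A \<equiv> (\<Union>e\<in>A. {(tail G e, head G e), (head G e, tail G e)})"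

lemma sym_rtrancl_adjacency: "sym ((adjacency G A)\<^sup>*)"
  by (rule sym_rtrancl) (auto simp: sym_def)

lemma grad_indicator_component:
  assumes "e \<in> A"
  shows "grad G (\<lambda>v. of_bool ((x, v) \<in> (adjacency G A)\<^sup>*)) e = 0"
proof -
  have "(tail G e, head G e) \<in> adjacency G A" "(head G e, tail G e) \<in> adjacency G A"
    using assms by auto
  then have "(x, tail G e) \<in> (adjacency G A)\<^sup>* \<longleftrightarrow> (x, head G e) \<in> (adjacency G A)\<^sup>*"
    by (meson rtrancl.rtrancl_into_rtrancl)
  then show ?thesis by (simp add: grad_def)
qed

text \<open>
  Induction on the set of arcs.  A new arc inside a component changes the energy form by a term of
  rank one, and the potentials change by the Sherman--Morrison formula; a new arc \<open>i\<close> between two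
  components carries no current except between its own endpoints, and a multiple of the indicator
  function of one component is the potential for \<open>i\<close>.
\<close>

lemma potential_exists:
  assumes "finite A" "\<And>a. a \<in> A \<Longrightarrow> 0 < L a" "(x, z) \<in> (adjacency G A)\<^sup>*"
  shows "\<exists>u. \<forall>k. energy (G\<lparr>arcs := A\<rparr>) L u k = k x - k z"
  using assms
proof (induction A arbitrary: x z rule: finite_induct)
  case empty
  then show ?case by (auto simp: energy_def)
next
  case (insert i A)
  let ?E = "energy (G\<lparr>arcs := A\<rparr>) L"
  let ?E' = "energy (G\<lparr>arcs := insert i A\<rparr>) L"
  note ins = energy_insert_arc[OF insert.hyps(1,2), of G L]
  have Li: "0 < L i" using insert.prems by auto
  have IH: "\<exists>u. \<forall>k. ?E u k = k x - k z" if "(x, z) \<in> (adjacency G A)\<^sup>*" for x z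
    using insert.IH insert.prems that by blast
  have IH_arc: "\<exists>u. \<forall>k. ?E u k = grad G k e" if "e \<in> A" for e
    unfolding grad_def by (rule IH) (use that in auto)
  have "(\<forall>e\<in>insert i A. \<exists>u. \<forall>k. ?E' u k = grad G k e)"
  proof (cases "(tail G i, head G i) \<in> (adjacency G A)\<^sup>*")
    case True
    then obtain u where u: "\<And>k. ?E u k = grad G k i"
      using IH[OF True] unfolding grad_def by blast
    have "0 \<le> ?E u u"
      by (rule energy_nonneg) (use insert.prems in auto)
    \<comment> \<open>\<open>grad G u i\<close> is the energy of \<open>u\<close>, so the
      denominator of the rank-one update stays positive.\<close>
    then have D: "0 < L i + grad G u i" using u Li by simp
    have upd: "\<exists>u'. \<forall>k. ?E' u' k = grad G k e" if w: "\<And>k. ?E w k = grad G k e" for w e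
    proof (intro exI allI)
      fix k
      define c where "c = grad G w i / (L i + grad G u i)"
      have c: "grad G w i = c * (L i + grad G u i)" using D by (simp add: c_def)
      show "?E' (\<lambda>x. w x - c * u x) k = grad G k e"
        unfolding ins grad_diff grad_scale energy_linear w u c using Li
        by (simp add: field_simps)
    qed
    show ?thesis using upd IH_arc u by blast
  next
    case False
    define w where "w v = (of_bool ((tail G i, v) \<in> (adjacency G A)\<^sup>*) :: real)" for v
    have gw: "grad G w e = 0" if "e \<in> A" for e
      unfolding w_def by (rule grad_indicator_component) fact
    have Ew: "?E w k = 0" for k
      using gw by (simp add: energy_def grad_def)
    have gi: "grad G w i = 1" using False by (simp add: grad_def w_def)
    have "\<exists>u. \<forall>k. ?E' u k = grad G k i"
    proof (intro exI allI)
      fix k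
      show "?E' (\<lambda>x. L i * w x) k = grad G k i"
        using Li by (simp add: ins grad_scale energy_linear Ew gi)
    qed
    moreover have "\<exists>u'. \<forall>k. ?E' u' k = grad G k e" if e: "e \<in> A" for e
    proof -
      obtain u where u: "\<And>k. ?E u k = grad G k e"
        using IH_arc[OF e] by blast
      \<comment> \<open>Since \<open>w\<close> has gradient 1 along \<open>i\<close> and 0 along all
        arcs of \<open>A\<close>, this correction stops the current through \<open>i\<close> and
        leaves the other currents unchanged.\<close>
      have "?E' (\<lambda>x. u x - grad G u i * w x) k = grad G k e" for k
        by (simp add: ins grad_scale grad_diff energy_linear Ew gi u)
      then show ?thesis by blast
    qed
    ultimately show ?thesis by auto
  qed
  then have arc: "\<exists>u. \<forall>k. ?E' u k = k x - k y" if "(x, y) \<in> adjacency G (insert i A)" for x y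
  proof -
    obtain e where e: "e \<in> insert i A"
      and xy: "(x, y) = (tail G e, head G e) \<or> (x, y) = (head G e, tail G e)"
      using \<open>(x, y) \<in> _\<close> by blast
    obtain u where u: "\<And>k. ?E' u k = grad G k e"
      using e \<open>\<forall>e\<in>insert i A. _ e\<close> by blast
    have "?E' (\<lambda>x. (-1) * u x) k = - grad G k e" for k
      by (simp only: energy_linear u)
    then show ?thesis using xy u unfolding grad_def by (metis minus_diff_eq prod.inject)
  qed
  show ?case using insert.prems(2)
  proof (induction rule: rtrancl_induct)
    case base
    have "?E' (\<lambda>_. 0) k = 0" for k by (simp add: energy_linear)
    then show ?case by force
  next
    case (step y z)
    obtain u where u: "\<And>k. ?E' u k = k x - k y" using step.IH by blast
    obtain w where w: "\<And>k. ?E' w k = k y - k z" using arc step.hyps(2) by blast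
    have "?E' (\<lambda>v. u v + w v) k = k x - k z" for k by (simp add: energy_linear u w)
    then show ?case by blast
  qed
qed

section \<open>Kirchhoff's law in weak form\<close>

lemma (in fin_digraph) net_current_conv:
  "net_current G L f v =
    (\<Sum>a\<in>arcs G. (of_bool (tail G a = v) - of_bool (head G a = v)) * (grad G f a / L a))"
proof -
  have "net_current G L f v =
    (\<Sum>a\<in>arcs G. if tail G a = v then grad G f a / L a else 0) -
    (\<Sum>a\<in>arcs G. if head G a = v then grad G f a / L a else 0)"
    by (auto simp: net_current_def grad_def sum.inter_filter[OF finite_arcs, symmetric]
        sum_negf[symmetric] minus_divide_left intro!: sum.cong)
  also have "\<dots> =
    (\<Sum>a\<in>arcs G. (of_bool (tail G a = v) - of_bool (head G a = v)) * (grad G f a / L a))"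
    unfolding sum_subtractf[symmetric] by (rule sum.cong) auto
  finally show ?thesis .
qed

text \<open>Discrete Green's formula: summation by parts moves the gradient off the test
  function.\<close>

lemma (in fin_digraph) energy_conv_net_current:
  "energy G L f k = (\<Sum>v\<in>verts G. k v * net_current G L f v)"
proof -
  have "(\<Sum>v\<in>verts G. k v * net_current G L f v) =
    (\<Sum>a\<in>arcs G. \<Sum>v\<in>verts G.
      k v * ((of_bool (tail G a = v) - of_bool (head G a = v)) * (grad G f a / L a)))"
    unfolding net_current_conv sum_distrib_left by (rule sum.swap)
  also have "\<dots> = (\<Sum>a\<in>arcs G. grad G f a * grad G k a / L a)"
  proof (rule sum.cong[OF refl])
    fix a assume a: "a \<in> arcs G"
    have "(\<Sum>v\<in>verts G.
        k v * ((of_bool (tail G a = v) - of_bool (head G a = v)) * (grad G f a / L a))) =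
      ((\<Sum>v\<in>verts G. if tail G a = v then k v else 0) -
       (\<Sum>v\<in>verts G. if head G a = v then k v else 0)) * (grad G f a / L a)"
      unfolding sum_subtractf[symmetric] sum_distrib_right by (rule sum.cong) auto
    also have "\<dots> = grad G f a * grad G k a / L a"
      using a by (simp add: grad_def)
    finally show "(\<Sum>v\<in>verts G.
        k v * ((of_bool (tail G a = v) - of_bool (head G a = v)) * (grad G f a / L a))) =
      grad G f a * grad G k a / L a" .
  qed
  finally show ?thesis by (simp add: energy_def)
qed

lemma (in fin_digraph) net_current_unit_iff:
  assumes "y \<in> verts G" "z \<in> verts G"
  shows "(\<forall>v\<in>verts G. net_current G L f v = of_bool (v = y) - of_bool (v = z)) \<longleftrightarrow>
    (\<forall>k. energy G L f k = k y - k z)"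
proof
  assume N: "\<forall>v\<in>verts G. net_current G L f v = of_bool (v = y) - of_bool (v = z)"
  show "\<forall>k. energy G L f k = k y - k z"
  proof
    fix k
    have "energy G L f k = (\<Sum>v\<in>verts G. (if v = y then k v else 0) - (if v = z then k v else 0))"
      unfolding energy_conv_net_current using N by (intro sum.cong) auto
    then show "energy G L f k = k y - k z"
      using assms by (simp add: sum_subtractf)
  qed
next
  assume E: "\<forall>k. energy G L f k = k y - k z"
  show "\<forall>v\<in>verts G. net_current G L f v = of_bool (v = y) - of_bool (v = z)"
  proof
    fix v assume v: "v \<in> verts G"
    \<comment> \<open>Testing with the indicator of \<open>v\<close> isolates the net current at
      \<open>v\<close>.\<close>
    have "energy G L f (\<lambda>w. of_bool (w = v)) =
      (\<Sum>w\<in>verts G. if w = v then net_current G L f w else 0)"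
      unfolding energy_conv_net_current by (intro sum.cong) auto
    then show "net_current G L f v = of_bool (v = y) - of_bool (v = z)"
      using v E by (auto simp: eq_commute)
  qed
qed

text \<open>Connectedness is replaced by solvability of the weak equation, a property that passes to
  contractions by projecting potentials, with no argument about paths.\<close>

locale network = fin_digraph G for G :: "('a, 'b) pre_digraph" +
  fixes L :: "'b \<Rightarrow> real"
  assumes length_pos: "a \<in> arcs G \<Longrightarrow> 0 < L a"
    and potential_ex: "x \<in> verts G \<Longrightarrow> z \<in> verts G \<Longrightarrow> \<exists>u. \<forall>k. energy G L u k = k x - k z"

lemma metrized_graph_network:
  assumes "metrized_graph G L"
  shows "network G L"
proof -
  interpret metrized_graph G L by fact
  show ?thesis
  proof
    fix x z assume xz: "x \<in> verts G" "z \<in> verts G"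
    have "(x, z) \<in> rtrancl_on (verts G) (adjacency G (arcs G))"
      using connected xz
      by (auto simp: Digraph_Component.connected_def strongly_connected_def reachable_def
          parcs_mk_symmetric)
    then have "(x, z) \<in> (adjacency G (arcs G))\<^sup>*" by (rule rtrancl_on_rtranclI)
    from potential_exists[OF finite_arcs length_pos this]
    show "\<exists>u. \<forall>k. energy G L u k = k x - k z" by simp
  qed (rule length_pos)
qed

lemma network_del_arc:
  assumes "metrized_graph G L" "bridgeless G" "e \<in> arcs G"
  shows "network (pre_digraph.del_arc G e) L"
proof -
  interpret metrized_graph G L by fact
  interpret D: fin_digraph "del_arc e" by (rule fin_digraph_del_arc)
  show ?thesis
    by (rule metrized_graph_network, unfold_locales)
      (use assms length_pos in \<open>auto simp: bridgeless_def\<close>)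
qed

section \<open>Uniqueness of potentials and the Green's function\<close>

context network
begin

text \<open>Uniqueness up to a constant, by duality: pairing with a potential \<open>s\<close> of
  the unit current from \<open>x\<close> to \<open>z\<close> reads off the difference of the values
  at \<open>x\<close> and \<open>z\<close>.\<close>

lemma energy_eqD:
  assumes "\<And>k. energy G L u k = energy G L w k" "x \<in> verts G" "z \<in> verts G"
  shows "u x - u z = w x - w z"
proof -
  obtain s where s: "\<And>k. energy G L s k = k x - k z"
    using potential_ex[OF assms(2,3)] by blast
  have "u x - u z = energy G L u s" by (simp add: s energy_commute[of G L u])
  also have "\<dots> = energy G L w s" by (rule assms)
  also have "\<dots> = w x - w z" by (simp add: s energy_commute[of G L w])
  finally show ?thesis .
qed

text \<open>Passage from the weak equation to the definite description: a weak solution, shifted to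
  vanish at \<open>z\<close> and set to 0 outside the vertices, is the unique potential.\<close>

lemma voltage_eq:
  assumes u: "\<And>k. energy G L u k = k y - k z"
    and V: "x \<in> verts G" "y \<in> verts G" "z \<in> verts G"
  shows "voltage G L z x y = u x - u z"
proof -
  define f where "f v = (if v \<in> verts G then u v - u z else 0)" for v
  have pot: "is_potential G L z y h \<longleftrightarrow>
      h z = 0 \<and> (\<forall>v. v \<notin> verts G \<longrightarrow> h v = 0) \<and> (\<forall>k. energy G L h k = k y - k z)" for h
    unfolding is_potential_def net_current_unit_iff[OF V(2,3)] ..
  have "energy G L f k = energy G L u k" for k
    unfolding energy_def by (rule sum.cong) (auto simp: grad_def f_def)
  then have "is_potential G L z y f"
    using V u by (simp add: pot f_def)
  moreover have "h = f" if "is_potential G L z y h" for h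
  proof
    fix v
    show "h v = f v"
      using energy_eqD[of h u v z] that V u by (cases "v \<in> verts G") (auto simp: pot f_def)
  qed
  ultimately have "(THE f. is_potential G L z y f) = f" by (rule the_equality)
  then show ?thesis using V by (simp add: voltage_def f_def)
qed

text \<open>On vertices, \<open>green p x y\<close> is the voltage at \<open>y\<close> when unit
  current enters at \<open>x\<close> and exits at the grounded vertex \<open>p\<close>. The weak
  equation leaves the values outside \<open>verts G\<close> undetermined, hence the choice
  operator.\<close>

definition green :: "'a \<Rightarrow> 'a \<Rightarrow> 'a \<Rightarrow> real" where
  "green p x = (SOME u. (\<forall>k. energy G L u k = k x - k p) \<and> u p = 0)"

lemma
  assumes "x \<in> verts G" "p \<in> verts G"
  shows energy_green: "energy G L (green p x) k = k x - k p"
    and green_base: "green p x p = 0"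
proof -
  obtain u where "\<And>k. energy G L u k = k x - k p" using potential_ex[OF assms] by blast
  then have "(\<forall>k. energy G L (\<lambda>v. u v - u p) k = k x - k p) \<and> u p - u p = 0"
    by (simp add: energy_linear)
  from someI[where P = "\<lambda>u. (\<forall>k. energy G L u k = k x - k p) \<and> u p = 0", OF this]
  show "energy G L (green p x) k = k x - k p" "green p x p = 0"
    by (simp_all add: green_def)
qed

lemma green_eqI:
  assumes "\<And>k. energy G L u k = k x - k p" "x \<in> verts G" "y \<in> verts G" "p \<in> verts G"
  shows "green p x y = u y - u p"
  using energy_eqD[of "green p x" u y p] assms by (simp add: energy_green green_base)

text \<open>Reciprocity: both sides are the mutual energy of the two Green's functions.\<close>

lemma green_commute:
  assumes "x \<in> verts G" "y \<in> verts G" "p \<in> verts G"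
  shows "green p x y = green p y x"
proof -
  have "green p x y = energy G L (green p y) (green p x)"
    using assms by (simp add: energy_green green_base)
  also have "\<dots> = energy G L (green p x) (green p y)" by (rule energy_commute)
  also have "\<dots> = green p y x"
    using assms by (simp add: energy_green green_base)
  finally show ?thesis .
qed

lemma green_base_left:
  assumes "y \<in> verts G" "p \<in> verts G"
  shows "green p p y = 0"
  using assms by (simp add: green_commute[of p] green_base)

text \<open>
  The sum of \<open>L (R_a - R_b)^2 / (L + R)^2\<close> over the edges is the energy of \<open>\<lambda>x. green p x x\<close>,
  the effective resistance between \<open>x\<close> and \<open>p\<close>.
\<close>

definition base_energy :: "'a \<Rightarrow> real" where
  "base_energy p = energy G L (\<lambda>x. green p x x) (\<lambda>x. green p x x)"

text \<open>Moving the ground from \<open>p\<close> to \<open>q\<close> changes the diagonal by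
  \<open>- 2 * green p q x\<close> and a constant. The cross term and the square of this change are
  \<open>-4\<close> and \<open>+4\<close> times \<open>green p q q\<close>, so they cancel.\<close>

lemma base_energy_independent:
  assumes V: "p \<in> verts G" "q \<in> verts G"
  shows "base_energy p = base_energy q"
proof -
  let ?d = "\<lambda>p x. green p x x"
  have d: "?d q x = (?d p x - 2 * green p q x) + ?d p q" if x: "x \<in> verts G" for x
  proof -
    have "green q x x = (green p x x - green p q x) - (green p x q - green p q q)"
      by (rule green_eqI) (use V x in \<open>simp_all add: energy_linear energy_green\<close>)
    then show ?thesis using V x by (simp add: green_commute[of x q])
  qed
  have "base_energy q = energy G L (\<lambda>x. (?d p x - 2 * green p q x) + ?d p q)
      (\<lambda>x. (?d p x - 2 * green p q x) + ?d p q)"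
    unfolding base_energy_def energy_def
    by (rule sum.cong) (auto simp: grad_def d)
  also have "\<dots> = base_energy p - 4 * energy G L (green p q) (?d p)
      + 4 * energy G L (green p q) (green p q)"
    unfolding energy_linear base_energy_def energy_commute[of G L "?d p" "green p q"] by simp
  also have "\<dots> = base_energy p"
    using V by (simp add: energy_green green_base)
  finally show ?thesis ..
qed

end

section \<open>Dipole potentials and edge resistances\<close>

locale rooted_network = network G L for G :: "('a, 'b) pre_digraph" and L :: "'b \<Rightarrow> real" +
  fixes p :: 'a
  assumes root_in_verts: "p \<in> verts G"
begin

abbreviation g :: "'a \<Rightarrow> 'a \<Rightarrow> real" where "g \<equiv> green p"

abbreviation diag :: "'a \<Rightarrow> real" where "diag \<equiv> \<lambda>x. g x x"

definition dipole :: "'b \<Rightarrow> 'a \<Rightarrow> real" where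
  "dipole e v = g (tail G e) v - g (head G e) v"

definition res :: "'b \<Rightarrow> real" where
  "res e = grad G (dipole e) e"

lemma energy_dipole: "e \<in> arcs G \<Longrightarrow> energy G L (dipole e) k = grad G k e"
  unfolding dipole_def grad_def using root_in_verts
  by (simp add: energy_linear energy_green)

lemma dipole_eq_grad: "e \<in> arcs G \<Longrightarrow> v \<in> verts G \<Longrightarrow> dipole e v = grad G (g v) e"
  unfolding dipole_def grad_def using root_in_verts by (simp add: green_commute[of v])

lemma dipole_root: "e \<in> arcs G \<Longrightarrow> dipole e p = 0"
  unfolding dipole_def using root_in_verts by (simp add: green_base)

lemma dipole_loop: "tail G e = head G e \<Longrightarrow> dipole e v = 0"
  by (simp add: dipole_def)

lemma res_loop: "tail G e = head G e \<Longrightarrow> res e = 0"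
  by (simp add: res_def grad_def)

text \<open>Both sides are the mutual energy of the two dipoles.\<close>

lemma grad_dipole_commute:
  assumes "e \<in> arcs G" "a \<in> arcs G"
  shows "grad G (dipole e) a = grad G (dipole a) e"
  using energy_dipole[OF assms(1), of "dipole a"] energy_dipole[OF assms(2), of "dipole e"]
  by (simp add: energy_commute[of G L "dipole a"])

text \<open>The mixed Green values cancel by symmetry. Thus sum and difference of the end values of
  a dipole are \<open>grad G diag e\<close> and \<open>res e\<close>.\<close>

lemma dipole_sum:
  assumes "e \<in> arcs G"
  shows "dipole e (tail G e) + dipole e (head G e) = grad G diag e"
  using assms root_in_verts
  by (simp add: dipole_def grad_def green_commute[of "head G e" "tail G e"])

text \<open>The resistance is the energy of the dipole. If it were not positive, the dipole would
  have no gradient anywhere, yet its pairing with the indicator of the tail is 1.\<close>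

lemma res_pos:
  assumes e: "e \<in> arcs G" "tail G e \<noteq> head G e"
  shows "0 < res e"
proof (rule ccontr)
  assume "\<not> 0 < res e"
  moreover have E: "res e = energy G L (dipole e) (dipole e)"
    unfolding res_def energy_dipole[OF e(1)] ..
  moreover have "0 \<le> energy G L (dipole e) (dipole e)"
    by (rule energy_nonneg) (rule length_pos)
  ultimately have "(\<Sum>a\<in>arcs G. grad G (dipole e) a * grad G (dipole e) a / L a) = 0"
    by (simp add: energy_def)
  then have "\<forall>a\<in>arcs G. grad G (dipole e) a * grad G (dipole e) a / L a = 0"
    by (subst (asm) sum_nonneg_eq_0_iff) (auto simp: length_pos less_imp_le)
  then have "\<forall>a\<in>arcs G. grad G (dipole e) a = 0"
    using length_pos by fastforce
  then have "energy G L (dipole e) (\<lambda>v. of_bool (v = tail G e)) = 0"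
    by (simp add: energy_def)
  then show False using e by (simp add: energy_dipole) (simp add: grad_def)
qed

text \<open>The potential \<open>u\<close> of the unit current from tail to head in the graph
  without \<open>e\<close> is compared with the dipole of \<open>e\<close> in
  \<open>G\<close>.\<close>

lemma edge_in_network:
  fixes e
  defines "R \<equiv> edge_R G L e"
  assumes e: "e \<in> arcs G" and "network (pre_digraph.del_arc G e) L"
  shows edge_R_nonneg: "0 \<le> R"
    and res_eq_edge_R: "res e = L e * R / (L e + R)"
    and grad_diag_eq_edge:
      "grad G diag e = L e * (edge_Ra G L e p - edge_Rb G L e p) / (L e + R)"
proof -
  interpret D: network "del_arc e" L by fact
  have V: "tail G e \<in> verts (del_arc e)" "head G e \<in> verts (del_arc e)" "p \<in> verts (del_arc e)"
    using e root_in_verts by simp_all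
  have Le: "0 < L e" using e by (rule length_pos)
  obtain u where u: "\<And>k. energy (del_arc e) L u k = k (tail G e) - k (head G e)"
    using D.potential_ex[OF V(1,2)] by blast
  have R: "R = grad G u e"
    unfolding R_def edge_R_def eff_resistance_def grad_def
    by (rule D.voltage_eq) (use u V in auto)
  also have "\<dots> = energy (del_arc e) L u u" by (simp add: u grad_def)
  also have "\<dots> \<ge> 0" by (rule energy_nonneg) (rule D.length_pos)
  finally show R0: "0 \<le> R" .
  \<comment> \<open>Once \<open>e\<close> is put back, the voltage \<open>R\<close> drives the extra
    current \<open>R / L e\<close> through it, so \<open>u\<close> belongs to the total current
    \<open>1 + R / L e\<close>.\<close>
  have Eu: "energy G L u k = energy G L (\<lambda>v. (1 + R / L e) * dipole e v) k" for k
    unfolding energy_linear energy_dipole[OF e] energy_del_arc[OF finite_arcs e, of L u k] u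
    by (simp add: grad_def[of G k] R algebra_simps add_divide_distrib diff_divide_distrib)
  have dip: "u v - u p = (1 + R / L e) * dipole e v" if "v \<in> verts G" for v
    using energy_eqD[of u "\<lambda>v. (1 + R / L e) * dipole e v" v p] Eu that root_in_verts e
    by (simp add: dipole_root)
  have "R = (1 + R / L e) * res e"
    using dip[of "tail G e"] dip[of "head G e"] e
    by (simp add: R res_def grad_def algebra_simps)
  then show "res e = L e * R / (L e + R)"
    using Le R0 by (simp add: field_simps)
  obtain s where s: "\<And>k. energy (del_arc e) L s k = k p - k (head G e)"
    using D.potential_ex[OF V(3,2)] by blast
  have "edge_Ra G L e p = - u p - (- u (tail G e))"
    unfolding edge_Ra_def
    by (rule D.voltage_eq)
      (use energy_scale_left[of "del_arc e" L "-1" u] u V in \<open>simp_all\<close>)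
  moreover have "edge_Rb G L e p = s (tail G e) - s (head G e)"
    unfolding edge_Rb_def by (rule D.voltage_eq) (use s V in auto)
  \<comment> \<open>Reciprocity expresses the potential with source \<open>p\<close> through
    \<open>u\<close>.\<close>
  moreover have "s (tail G e) - s (head G e) = u p - u (head G e)"
    using u[of s] s[of u] by (simp add: energy_commute[of _ L u])
  ultimately have "edge_Ra G L e p - edge_Rb G L e p =
      (u (tail G e) - u p) + (u (head G e) - u p)"
    by simp
  also have "\<dots> = (1 + R / L e) * grad G diag e"
    using e by (simp add: dip dipole_sum[symmetric] distrib_left)
  finally show "grad G diag e = L e * (edge_Ra G L e p - edge_Rb G L e p) / (L e + R)"
    using Le R0 by (simp add: field_simps)
qed

text \<open>Foster's identity, as a trace: each \<open>g x\<close> is paired with the indicator of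
  \<open>x\<close>. Every vertex contributes 1 except the root, which contributes 0.\<close>

lemma sum_res_over_length: "(\<Sum>e\<in>arcs G. res e / L e) = real (card (verts G)) - 1"
proof -
  let ?\<delta> = "\<lambda>x v. of_bool (v = x) :: real"
  have "(\<Sum>x\<in>verts G. energy G L (g x) (?\<delta> x)) = (\<Sum>x\<in>verts G. 1 - (if x = p then 1 else 0))"
    by (rule sum.cong) (use root_in_verts in \<open>auto simp: energy_green\<close>)
  also have "\<dots> = real (card (verts G)) - 1"
    using root_in_verts by (simp add: sum_subtractf)
  also have "(\<Sum>x\<in>verts G. energy G L (g x) (?\<delta> x)) =
      (\<Sum>e\<in>arcs G. \<Sum>x\<in>verts G. grad G (g x) e * grad G (?\<delta> x) e / L e)"
    unfolding energy_def by (rule sum.swap)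
  also have "\<dots> = (\<Sum>e\<in>arcs G. res e / L e)"
  proof (rule sum.cong[OF refl])
    fix e assume e: "e \<in> arcs G"
    have "(\<Sum>x\<in>verts G. grad G (g x) e * grad G (?\<delta> x) e / L e) =
      ((\<Sum>x\<in>verts G. if tail G e = x then grad G (g x) e else 0) -
       (\<Sum>x\<in>verts G. if head G e = x then grad G (g x) e else 0)) / L e"
      unfolding sum_subtractf[symmetric] sum_divide_distrib
      by (rule sum.cong) (auto simp: grad_def)
    also have "\<dots> = res e / L e"
      using e by (simp add: res_def grad_def[of _ "dipole e"] dipole_eq_grad)
    finally show "(\<Sum>x\<in>verts G. grad G (g x) e * grad G (?\<delta> x) e / L e) = res e / L e" .
  qed
  finally show ?thesis .
qed

end

text \<open>Bridgelessness, too, is stated as solvability, so that it can be carried over to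
  contractions.\<close>

locale bridgeless_network = network G L for G :: "('a, 'b) pre_digraph" and L :: "'b \<Rightarrow> real" +
  assumes network_del: "e \<in> arcs G \<Longrightarrow> network (pre_digraph.del_arc G e) L"

section \<open>The invariants in terms of the Green's function\<close>

locale rooted_bridgeless_network = bridgeless_network G L + rooted_network G L p
  for G :: "('a, 'b) pre_digraph" and L :: "'b \<Rightarrow> real" and p :: 'a
begin

lemma edge_R_ratio:
  assumes "e \<in> arcs G"
  shows "edge_R G L e / (L e + edge_R G L e) = res e / L e"
  using length_pos[OF assms] res_eq_edge_R[OF assms network_del[OF assms]] by simp

lemma y_inv_conv: "y_inv G L p = 1/4 * (\<Sum>e\<in>arcs G. (res e)\<^sup>2 / L e) + 3/4 * base_energy p"
proof -
  have "(\<Sum>e\<in>arcs G. L e * (edge_R G L e)^2 / (L e + edge_R G L e)^2) =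
      (\<Sum>e\<in>arcs G. (res e)\<^sup>2 / L e)"
  proof (rule sum.cong[OF refl])
    fix e assume e: "e \<in> arcs G"
    show "L e * (edge_R G L e)^2 / (L e + edge_R G L e)^2 = (res e)\<^sup>2 / L e"
      unfolding res_eq_edge_R[OF e network_del[OF e]] using length_pos[OF e]
      by (simp add: power_divide power_mult_distrib power2_eq_square)
  qed
  moreover have
    "(\<Sum>e\<in>arcs G. L e * (edge_Ra G L e p - edge_Rb G L e p)^2 / (L e + edge_R G L e)^2) =
      base_energy p"
    unfolding base_energy_def energy_def
  proof (rule sum.cong[OF refl])
    fix e assume e: "e \<in> arcs G"
    show "L e * (edge_Ra G L e p - edge_Rb G L e p)^2 / (L e + edge_R G L e)^2 =
        grad G diag e * grad G diag e / L e"
      unfolding grad_diag_eq_edge[OF e network_del[OF e]] using length_pos[OF e]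
      by (simp add: power_divide power_mult_distrib power2_eq_square)
  qed
  ultimately show ?thesis by (simp add: y_inv_def)
qed

lemma x_inv_conv: "x_inv G L p = (\<Sum>e\<in>arcs G. res e) - y_inv G L p"
proof -
  have "(\<Sum>e\<in>arcs G. res e) = (\<Sum>e\<in>arcs G. (L e)^2 * edge_R G L e / (L e + edge_R G L e)^2) +
    (\<Sum>e\<in>arcs G. L e * (edge_R G L e)^2 / (L e + edge_R G L e)^2)"
    unfolding sum.distrib[symmetric]
  proof (rule sum.cong[OF refl])
    fix e assume e: "e \<in> arcs G"
    have "L e + edge_R G L e \<noteq> 0"
      using length_pos[OF e] edge_R_nonneg[OF e network_del[OF e]] by simp
    then show "res e = (L e)^2 * edge_R G L e / (L e + edge_R G L e)^2 +
        L e * (edge_R G L e)^2 / (L e + edge_R G L e)^2"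
      unfolding res_eq_edge_R[OF e network_del[OF e]]
      by (simp add: divide_simps power2_eq_square) (simp add: algebra_simps)
  qed
  then show ?thesis by (simp add: x_inv_def y_inv_def)
qed

end

context bridgeless_network
begin

text \<open>\<open>res\<close> is determined by \<open>edge_R\<close>, which involves no root; the
  remaining term is \<open>base_energy\<close>.\<close>

lemma inv_independent:
  assumes "p \<in> verts G" "q \<in> verts G"
  shows y_inv_independent: "y_inv G L p = y_inv G L q"
    and x_inv_independent: "x_inv G L p = x_inv G L q"
proof -
  interpret P: rooted_bridgeless_network G L p by unfold_locales (rule assms)
  interpret Q: rooted_bridgeless_network G L q by unfold_locales (rule assms)
  have res: "P.res e = Q.res e" if "e \<in> arcs G" for e
    using that network_del by (simp add: P.res_eq_edge_R Q.res_eq_edge_R)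
  show y: "y_inv G L p = y_inv G L q"
    by (simp add: P.y_inv_conv Q.y_inv_conv res base_energy_independent[OF assms])
  show "x_inv G L p = x_inv G L q"
    by (simp add: P.x_inv_conv Q.x_inv_conv res y)
qed

end

section \<open>Contraction of an edge\<close>

definition merge :: "('a, 'b) pre_digraph \<Rightarrow> 'b \<Rightarrow> 'a \<Rightarrow> 'a" where
  "merge G i v = (if v = head G i then tail G i else v)"

lemma contract_arc_simps:
  "verts (contract_arc G i) = merge G i ` verts G"
  "arcs (contract_arc G i) = arcs G - {i}"
  "tail (contract_arc G i) a = merge G i (tail G a)"
  "head (contract_arc G i) a = merge G i (head G a)"
  by (simp_all add: contract_arc_def merge_def fun_eq_iff)

lemma grad_contract: "grad (contract_arc G i) f a = grad G (\<lambda>v. f (merge G i v)) a"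
  by (simp add: grad_def contract_arc_simps)

lemma grad_merge: "grad G (\<lambda>v. f (merge G i v)) i = 0"
  by (simp add: grad_def merge_def)

lemma merge_invariant: "grad G f i = 0 \<Longrightarrow> f (merge G i v) = f v"
  by (simp add: grad_def merge_def)

text \<open>Functions on the contraction are pulled back along \<open>merge\<close>; the pullbacks
  have no gradient along \<open>i\<close>, so the removed arc contributes nothing.\<close>

lemma (in fin_digraph) energy_contract:
  "energy (contract_arc G i) L f k =
    energy G L (\<lambda>v. f (merge G i v)) (\<lambda>v. k (merge G i v))"
  by (cases "i \<in> arcs G")
    (simp_all add: energy_def contract_arc_simps grad_contract sum.remove[of "arcs G" i] grad_merge)

lemma contract_del_arc:
  "contract_arc (pre_digraph.del_arc G e) i = pre_digraph.del_arc (contract_arc G i) e"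
  by (auto simp: contract_arc_def pre_digraph.del_arc_def Let_def)

context rooted_network
begin

text \<open>The corrected function is the energy-orthogonal projection of \<open>f\<close> onto the
  functions with equal values at both ends of \<open>i\<close>.\<close>

lemma grad_project:
  assumes "i \<in> arcs G" "tail G i \<noteq> head G i"
  shows "grad G (\<lambda>v. f v - grad G f i / res i * dipole i v) i = 0"
  unfolding grad_diff grad_scale res_def[symmetric] using res_pos[OF assms] by simp

text \<open>The dipole is orthogonal to all pullbacks along \<open>merge\<close>, so projecting a
  potential of \<open>G\<close> gives one of the contraction.\<close>

lemma energy_project:
  assumes "i \<in> arcs G" "tail G i \<noteq> head G i"
  shows "energy (contract_arc G i) L (\<lambda>v. f v - grad G f i / res i * dipole i v) k =
    energy G L f (\<lambda>v. k (merge G i v))"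
  unfolding energy_contract merge_invariant[OF grad_project[OF assms]]
  unfolding energy_linear using assms by (simp add: energy_dipole grad_merge)

lemma network_contract:
  assumes i: "i \<in> arcs G" "tail G i \<noteq> head G i"
  shows "network (contract_arc G i) L"
proof
  fix x z assume "x \<in> verts (contract_arc G i)" "z \<in> verts (contract_arc G i)"
  then obtain x' z' where V: "x' \<in> verts G" "z' \<in> verts G"
    and x: "x = merge G i x'" and z: "z = merge G i z'"
    by (auto simp: contract_arc_simps)
  obtain u where "\<And>k. energy G L u k = k x' - k z'" using potential_ex[OF V] by blast
  then have "energy (contract_arc G i) L (\<lambda>v. u v - grad G u i / res i * dipole i v) k = k x - k z"
    for k by (simp only: energy_project[OF i] x z)
  then show "\<exists>u. \<forall>k. energy (contract_arc G i) L u k = k x - k z" by blast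
qed (auto simp: contract_arc_simps length_pos)

end

lemma (in network) network_contract:
  assumes "i \<in> arcs G" "tail G i \<noteq> head G i"
  shows "network (contract_arc G i) L"
proof -
  \<comment> \<open>The projection needs a Green's function; any vertex can serve as its
    ground.\<close>
  interpret rooted_network G L "tail G i" by unfold_locales (use assms in auto)
  show ?thesis using assms by (rule network_contract)
qed

text \<open>Deletion and contraction commute, so the graph without \<open>e\<close> can be
  contracted instead.\<close>

lemma (in bridgeless_network) bridgeless_network_contract:
  assumes i: "i \<in> arcs G" "tail G i \<noteq> head G i"
  shows "bridgeless_network (contract_arc G i) L"
proof -
  show ?thesis
  proof (intro bridgeless_network.intro bridgeless_network_axioms.intro)
    show "network (contract_arc G i) L" by (rule network_contract) fact+
    fix e assume "e \<in> arcs (contract_arc G i)"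
    then have e: "e \<in> arcs G" "e \<noteq> i" by (auto simp: contract_arc_simps)
    interpret D: network "del_arc e" L using e(1) by (rule network_del)
    show "network (pre_digraph.del_arc (contract_arc G i) e) L"
      using D.network_contract[of i] i e by (simp add: contract_del_arc)
  qed
qed

text \<open>
  With \<open>a, b\<close> the values of \<open>s\<close> at the two ends of an edge, this is
  \<open>(a + b)\<^sup>2 = 4/3 (a\<^sup>2 + a b + b\<^sup>2) - 1/3 (a - b)\<^sup>2\<close>.
\<close>

lemma energy_square:
  "energy G L (\<lambda>v. (s v)\<^sup>2) (\<lambda>v. (s v)\<^sup>2) =
    4/3 * energy G L s (\<lambda>v. s v ^ 3) - 1/3 * (\<Sum>a\<in>arcs G. grad G s a ^ 4 / L a)"
proof -
  have "((a :: real)\<^sup>2 - b\<^sup>2) * (a\<^sup>2 - b\<^sup>2) = 4/3 * ((a - b) * (a^3 - b^3)) - 1/3 * (a - b) ^ 4" for a b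
    by (simp add: eval_nat_numeral algebra_simps)
  then show ?thesis
    unfolding energy_def sum_distrib_left sum_subtractf[symmetric]
    by (intro sum.cong) (simp_all add: grad_def diff_divide_distrib)
qed

section \<open>Green's function and invariants of the contraction\<close>

context rooted_bridgeless_network
begin

context
  fixes i
  assumes i: "i \<in> arcs G" "tail G i \<noteq> head G i"
begin

interpretation C: bridgeless_network "contract_arc G i" L
  using i by (rule bridgeless_network_contract)

interpretation C: rooted_bridgeless_network "contract_arc G i" L "merge G i p"
  by unfold_locales (simp add: contract_arc_simps root_in_verts)

lemma green_contract:
  assumes "x \<in> verts G" "y \<in> verts G"
  shows "C.g (merge G i x) (merge G i y) = g x y - dipole i x * dipole i y / res i"
proof -
  let ?u = "\<lambda>v. g x v - grad G (g x) i / res i * dipole i v"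
  note inv = merge_invariant[OF grad_project[OF i]]
  have "C.g (merge G i x) (merge G i y) = ?u (merge G i y) - ?u (merge G i p)"
    by (rule C.green_eqI)
      (use assms root_in_verts in
        \<open>simp_all only: energy_project[OF i] energy_green contract_arc_simps imageI\<close>)
  also have "\<dots> = ?u y - ?u p" by (simp only: inv)
  also have "\<dots> = g x y - dipole i x * dipole i y / res i"
    using assms root_in_verts i by (simp add: green_base dipole_root dipole_eq_grad[of i x])
  finally show ?thesis .
qed

lemma res_contract:
  assumes a: "a \<in> arcs G"
  shows "C.res a = res a - (grad G (dipole i) a)\<^sup>2 / res i"
  using a
  by (simp add: C.res_def res_def C.dipole_def dipole_def[of a] grad_def contract_arc_simps
      green_contract algebra_simps power2_eq_square add_divide_distrib diff_divide_distrib)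

text \<open>The correction formula gives 0 at \<open>i\<close> itself, so sums over the contraction
  extend to all arcs of \<open>G\<close>.\<close>

lemma res_contract_self: "res i - (grad G (dipole i) i)\<^sup>2 / res i = 0"
  using res_pos[OF i] by (simp add: power2_eq_square flip: res_def)

text \<open>The diagonal loses \<open>s\<^sup>2 / r\<close>. The energy of \<open>s\<^sup>2\<close>
  is reduced by \<open>energy_square\<close> to a pairing of the dipole with its own cube, which the
  weak equation evaluates at the ends of \<open>i\<close>.\<close>

lemma base_energy_contract:
  "C.base_energy (merge G i p) = base_energy p
    - 2 * (energy G L diag (\<lambda>v. (dipole i v)\<^sup>2) / res i)
    + (3 * (grad G diag i)\<^sup>2 + (res i)\<^sup>2) / (3 * res i)
    - 1/3 * ((\<Sum>a\<in>arcs G. grad G (dipole i) a ^ 4 / L a) / (res i)\<^sup>2)"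
proof -
  let ?s = "dipole i" and ?r = "res i"
  let ?D = "\<lambda>v. g v v - (1 / ?r) * (?s v)\<^sup>2"
  have r: "?r \<noteq> 0" using res_pos[OF i] by simp
  have "C.base_energy (merge G i p) = energy G L ?D ?D"
    unfolding C.base_energy_def energy_contract unfolding energy_def
    by (rule sum.cong) (auto simp: grad_def green_contract power2_eq_square)
  also have "\<dots> = base_energy p - 2 * (energy G L diag (\<lambda>v. (?s v)\<^sup>2) / ?r)
      + energy G L (\<lambda>v. (?s v)\<^sup>2) (\<lambda>v. (?s v)\<^sup>2) / ?r\<^sup>2"
    unfolding energy_linear base_energy_def energy_commute[of G L "\<lambda>v. (?s v)\<^sup>2" diag]
    by (simp add: power2_eq_square algebra_simps)
  also have "energy G L (\<lambda>v. (?s v)\<^sup>2) (\<lambda>v. (?s v)\<^sup>2) =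
      4/3 * (?s (tail G i) ^ 3 - ?s (head G i) ^ 3)
      - 1/3 * (\<Sum>a\<in>arcs G. grad G ?s a ^ 4 / L a)"
    unfolding energy_square energy_dipole[OF i(1)] by (simp add: grad_def)
  \<comment> \<open>A difference of cubes is rewritten through the difference \<open>?r\<close> and
    the sum \<open>grad G diag i\<close> of the end values.\<close>
  also have "?s (tail G i) ^ 3 - ?s (head G i) ^ 3 = ?r * (3 * (grad G diag i)\<^sup>2 + ?r\<^sup>2) / 4"
  proof -
    have "a ^ 3 - b ^ 3 = (a - b) * (3 * (a + b)\<^sup>2 + (a - b)\<^sup>2) / 4" for a b :: real
      by (simp add: eval_nat_numeral algebra_simps)
    from this[of "?s (tail G i)" "?s (head G i)"] show ?thesis
      unfolding dipole_sum[OF i(1)] res_def grad_def[of G ?s] .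
  qed
  finally show ?thesis
    using r by (simp add: diff_divide_distrib power2_eq_square)
qed

text \<open>The fourth-order sum enters with coefficient \<open>1/4 - 3/4 * 1/3 = 0\<close>.\<close>

lemma y_inv_contract:
  "y_inv (contract_arc G i) L (merge G i p) = y_inv G L p
    - 1/2 * ((\<Sum>a\<in>arcs G. res a * (grad G (dipole i) a)\<^sup>2 / L a) / res i)
    - 3/2 * (energy G L diag (\<lambda>v. (dipole i v)\<^sup>2) / res i)
    + (3 * (grad G diag i)\<^sup>2 + (res i)\<^sup>2) / (4 * res i)"
proof -
  have "(\<Sum>a\<in>arcs (contract_arc G i). (C.res a)\<^sup>2 / L a) =
      (\<Sum>a\<in>arcs G. (res a - (grad G (dipole i) a)\<^sup>2 / res i)\<^sup>2 / L a)"
    using i(1) by (simp add: contract_arc_simps sum.remove[of "arcs G" i] res_contract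
        res_contract_self)
  also have "\<dots> = (\<Sum>a\<in>arcs G. (res a)\<^sup>2 / L a)
      - 2 * ((\<Sum>a\<in>arcs G. res a * (grad G (dipole i) a)\<^sup>2 / L a) / res i)
      + (\<Sum>a\<in>arcs G. grad G (dipole i) a ^ 4 / L a) / (res i)\<^sup>2"
    unfolding sum_distrib_left sum_divide_distrib sum_subtractf[symmetric] sum.distrib[symmetric]
    by (rule sum.cong) (simp_all add: eval_nat_numeral algebra_simps add_divide_distrib
        diff_divide_distrib)
  finally have "(\<Sum>a\<in>arcs (contract_arc G i). (C.res a)\<^sup>2 / L a) = \<dots>" .
  moreover have "(3 * (grad G diag i)\<^sup>2 + (res i)\<^sup>2) / (3 * res i) =
      4/3 * ((3 * (grad G diag i)\<^sup>2 + (res i)\<^sup>2) / (4 * res i))"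
    by (cases "res i = 0") (simp_all add: field_simps)
  moreover have "1/4 * (a - 2 * b + c) + 3/4 * (e - 2 * f + 4/3 * d - 1/3 * c) =
      1/4 * a + 3/4 * e - 1/2 * b - 3/2 * f + d" for a b c d e f :: real
    by (simp add: algebra_simps)
  ultimately show ?thesis
    unfolding C.y_inv_conv y_inv_conv base_energy_contract by (simp only:)
qed

lemma x_plus_y_inv_contract:
  "x_inv (contract_arc G i) L (merge G i p) + y_inv (contract_arc G i) L (merge G i p) =
    (\<Sum>a\<in>arcs G. res a) - (\<Sum>a\<in>arcs G. (grad G (dipole i) a)\<^sup>2) / res i"
proof -
  have "(\<Sum>a\<in>arcs (contract_arc G i). C.res a) =
      (\<Sum>a\<in>arcs G. res a - (grad G (dipole i) a)\<^sup>2 / res i)"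
    using i(1) by (simp add: contract_arc_simps sum.remove[of "arcs G" i] res_contract
        res_contract_self)
  then show ?thesis
    by (simp add: C.x_inv_conv sum_subtractf sum_divide_distrib)
qed

end

section \<open>Weighted sums over the contracted edges\<close>

lemma sum_grad_dipole_squared:
  assumes "a \<in> arcs G"
  shows "(\<Sum>i\<in>arcs G. (grad G (dipole i) a)\<^sup>2 / L i) = res a"
proof -
  have "(\<Sum>i\<in>arcs G. (grad G (dipole i) a)\<^sup>2 / L i) = energy G L (dipole a) (dipole a)"
    unfolding energy_def
    by (rule sum.cong) (simp_all add: grad_dipole_commute[OF _ assms] power2_eq_square)
  then show ?thesis by (simp add: energy_dipole[OF assms] res_def)
qed

lemma sum_dipole_squared:
  assumes "v \<in> verts G"
  shows "(\<Sum>i\<in>arcs G. (dipole i v)\<^sup>2 / L i) = g v v"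
proof -
  have "(\<Sum>i\<in>arcs G. (dipole i v)\<^sup>2 / L i) = energy G L (g v) (g v)"
    unfolding energy_def
    by (rule sum.cong) (simp_all add: dipole_eq_grad[OF _ assms] power2_eq_square)
  then show ?thesis using assms root_in_verts by (simp add: energy_green green_base)
qed

text \<open>After interchanging the sums, \<open>sum_dipole_squared\<close> applies at both ends of
  each arc.\<close>

lemma sum_energy_dipole_squared:
  "(\<Sum>i\<in>arcs G. energy G L diag (\<lambda>v. (dipole i v)\<^sup>2) / L i) = base_energy p"
proof -
  have "(\<Sum>i\<in>arcs G. energy G L diag (\<lambda>v. (dipole i v)\<^sup>2) / L i) =
      (\<Sum>i\<in>arcs G. \<Sum>a\<in>arcs G.
        grad G diag a * grad G (\<lambda>v. (dipole i v)\<^sup>2 / L i) a / L a)"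
    unfolding energy_def sum_divide_distrib
    by (intro sum.cong) (simp_all add: grad_def flip: diff_divide_distrib)
  also have "\<dots> = (\<Sum>a\<in>arcs G. \<Sum>i\<in>arcs G.
        grad G diag a * grad G (\<lambda>v. (dipole i v)\<^sup>2 / L i) a / L a)"
    by (rule sum.swap)
  also have "\<dots> = base_energy p"
    unfolding base_energy_def energy_def
    by (intro sum.cong)
      (simp_all add: grad_def sum_subtractf sum_dipole_squared
        flip: sum_distrib_left sum_divide_distrib)
  finally show ?thesis .
qed

text \<open>Foster's identity gives \<open>v - 1\<close> copies of \<open>y\<close>. The corrections
  add up to \<open>-1/4\<close> times the sum of \<open>r\<^sup>2 / L\<close> and
  \<open>-3/4\<close> times \<open>base_energy p\<close>, which is exactly
  \<open>-y\<close>.\<close>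

lemma sum_y_inv_contract:
  "(\<Sum>i\<in>arcs G. edge_R G L i / (L i + edge_R G L i) *
      y_inv (contract_arc G i) L (merge G i p)) = (real (card (verts G)) - 2) * y_inv G L p"
proof -
  let ?m = "\<lambda>i a. grad G (dipole i) a"
  have "(\<Sum>i\<in>arcs G. edge_R G L i / (L i + edge_R G L i) *
      y_inv (contract_arc G i) L (merge G i p)) =
    (\<Sum>i\<in>arcs G. res i / L i * y_inv G L p
      - 1/2 * ((\<Sum>a\<in>arcs G. res a * (?m i a)\<^sup>2 / L a) / L i)
      - 3/2 * (energy G L diag (\<lambda>v. (dipole i v)\<^sup>2) / L i)
      + 3/4 * (grad G diag i * grad G diag i / L i) + 1/4 * ((res i)\<^sup>2 / L i))"
  proof (rule sum.cong[OF refl])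
    fix i assume i: "i \<in> arcs G"
    show "edge_R G L i / (L i + edge_R G L i) * y_inv (contract_arc G i) L (merge G i p) =
      res i / L i * y_inv G L p
      - 1/2 * ((\<Sum>a\<in>arcs G. res a * (?m i a)\<^sup>2 / L a) / L i)
      - 3/2 * (energy G L diag (\<lambda>v. (dipole i v)\<^sup>2) / L i)
      + 3/4 * (grad G diag i * grad G diag i / L i) + 1/4 * ((res i)\<^sup>2 / L i)"
    \<comment> \<open>A loop has resistance 0 and so weight 0; the contraction formulas require
      distinct ends.\<close>
    proof (cases "tail G i = head G i")
      case True
      then show ?thesis unfolding edge_R_ratio[OF i]
        by (simp add: res_loop dipole_loop grad_def energy_const_right)
    next
      case False
      show ?thesis
        unfolding edge_R_ratio[OF i] y_inv_contract[OF i False]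
        using res_pos[OF i False] length_pos[OF i]
        by (simp add: field_simps power2_eq_square)
    qed
  qed
  also have "\<dots> = (real (card (verts G)) - 1) * y_inv G L p
      - 1/2 * (\<Sum>i\<in>arcs G. (\<Sum>a\<in>arcs G. res a * (?m i a)\<^sup>2 / L a) / L i)
      - 3/2 * base_energy p + 3/4 * base_energy p + 1/4 * (\<Sum>i\<in>arcs G. (res i)\<^sup>2 / L i)"
    unfolding sum.distrib sum_subtractf base_energy_def[of p] energy_def[of G L diag diag]
      sum_distrib_left[symmetric] sum_distrib_right[symmetric] sum_res_over_length
      sum_energy_dipole_squared[unfolded base_energy_def energy_def[of G L diag diag]] ..
  also have "(\<Sum>i\<in>arcs G. (\<Sum>a\<in>arcs G. res a * (?m i a)\<^sup>2 / L a) / L i) =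
      (\<Sum>a\<in>arcs G. (res a)\<^sup>2 / L a)"
  proof -
    have "(\<Sum>i\<in>arcs G. (\<Sum>a\<in>arcs G. res a * (?m i a)\<^sup>2 / L a) / L i) =
        (\<Sum>a\<in>arcs G. \<Sum>i\<in>arcs G. res a / L a * ((?m i a)\<^sup>2 / L i))"
      unfolding sum_divide_distrib by (subst sum.swap) (simp add: field_simps)
    also have "\<dots> = (\<Sum>a\<in>arcs G. res a / L a * res a)"
      unfolding sum_distrib_left[symmetric] by (simp add: sum_grad_dipole_squared)
    finally show ?thesis by (simp add: power2_eq_square)
  qed
  finally show ?thesis
    unfolding left_diff_distrib using y_inv_conv by linarith
qed

text \<open>The sum \<open>x + y\<close> is simpler, being the total resistance; its correction is
  one further copy of that total. Subtracting the identity for \<open>y\<close> leaves the one for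
  \<open>x\<close>.\<close>

lemma sum_x_inv_contract:
  "(\<Sum>i\<in>arcs G. edge_R G L i / (L i + edge_R G L i) *
      x_inv (contract_arc G i) L (merge G i p)) = (real (card (verts G)) - 2) * x_inv G L p"
proof -
  let ?m = "\<lambda>i a. grad G (dipole i) a"
  have "(\<Sum>i\<in>arcs G. edge_R G L i / (L i + edge_R G L i) *
      (x_inv (contract_arc G i) L (merge G i p) + y_inv (contract_arc G i) L (merge G i p))) =
    (\<Sum>i\<in>arcs G. res i / L i * (\<Sum>a\<in>arcs G. res a) - (\<Sum>a\<in>arcs G. (?m i a)\<^sup>2 / L i))"
  proof (rule sum.cong[OF refl])
    fix i assume i: "i \<in> arcs G"
    show "edge_R G L i / (L i + edge_R G L i) *
      (x_inv (contract_arc G i) L (merge G i p) + y_inv (contract_arc G i) L (merge G i p)) =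
      res i / L i * (\<Sum>a\<in>arcs G. res a) - (\<Sum>a\<in>arcs G. (?m i a)\<^sup>2 / L i)"
    proof (cases "tail G i = head G i")
      case True
      then show ?thesis unfolding edge_R_ratio[OF i]
        by (simp add: res_loop dipole_loop grad_def)
    next
      case False
      show ?thesis
        unfolding edge_R_ratio[OF i] x_plus_y_inv_contract[OF i False]
        using res_pos[OF i False] length_pos[OF i]
        by (simp add: field_simps flip: sum_divide_distrib)
    qed
  qed
  also have "\<dots> = (real (card (verts G)) - 1) * (\<Sum>a\<in>arcs G. res a)
      - (\<Sum>a\<in>arcs G. \<Sum>i\<in>arcs G. (?m i a)\<^sup>2 / L i)"
    unfolding sum_subtractf sum_distrib_right[symmetric] sum_res_over_length
    by (subst sum.swap) (rule refl)
  also have "\<dots> = (real (card (verts G)) - 2) * (\<Sum>a\<in>arcs G. res a)"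
    by (simp add: sum_grad_dipole_squared algebra_simps)
  finally show ?thesis
    using sum_y_inv_contract by (simp add: x_inv_conv distrib_left sum.distrib algebra_simps)
qed

end

section \<open>The identities for arbitrary base vertices\<close>

theorem theorem4p14:
  fixes G :: "('a, 'b) pre_digraph" and L :: "'b \<Rightarrow> real" and p :: 'a and q :: "'b \<Rightarrow> 'a"
  assumes "metrized_graph G L"
    and "bridgeless G"
    and "card (verts G) \<ge> 2"
    and "p \<in> verts G"
    and "\<And>e. e \<in> arcs G \<Longrightarrow> q e \<in> verts (contract_arc G e)"
  shows "(real (card (verts G)) - 2) * x_inv G L p =
      (\<Sum>e \<in> arcs G. edge_R G L e / (L e + edge_R G L e) * x_inv (contract_arc G e) L (q e)) \<and>
    (real (card (verts G)) - 2) * y_inv G L p =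
      (\<Sum>e \<in> arcs G. edge_R G L e / (L e + edge_R G L e) * y_inv (contract_arc G e) L (q e))"
proof -
  interpret network G L using assms(1) by (rule metrized_graph_network)
  interpret bridgeless_network G L
    by (intro bridgeless_network.intro bridgeless_network_axioms.intro network_axioms)
      (rule network_del_arc[OF assms(1,2)])
  interpret rooted_bridgeless_network G L p
    by unfold_locales (rule assms)
  \<comment> \<open>Independence of the base vertex replaces \<open>q e\<close> by the image of
    \<open>p\<close>; for loops both sides have weight 0.\<close>
  have base: "edge_R G L e / (L e + edge_R G L e) * h (contract_arc G e) L (q e) =
      edge_R G L e / (L e + edge_R G L e) * h (contract_arc G e) L (merge G e p)"
    if e: "e \<in> arcs G" and h: "h = x_inv \<or> h = y_inv" for e and h
  proof (cases "tail G e = head G e")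
    case True
    then show ?thesis by (simp add: edge_R_ratio[OF e] res_loop)
  next
    case False
    interpret C: bridgeless_network "contract_arc G e" L
      using e False by (rule bridgeless_network_contract)
    have "merge G e p \<in> verts (contract_arc G e)"
      using assms(4) by (simp add: contract_arc_simps)
    then show ?thesis
      using h C.inv_independent[OF assms(5)[OF e], of "merge G e p"] by auto
  qed
  show ?thesis
    using sum_x_inv_contract sum_y_inv_contract
    by (simp only: base[where h = x_inv] base[where h = y_inv] simp_thms cong: sum.cong)
qed

end
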